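(* The categories $\mathbf{LSS}$ and $\mathbf{LocS}$ are adjoint. Precisely: the functor $\Omega:\mathbf{LSS}\to\mathbf{LocS}$ given by $\Omega(X,\mathcal{L}_X)=(\mathcal{L}_X^{wo},\mathcal{L}_X)$ on objects and $\Omega(f)=(\mathcal{L}^{wo}f)_*$ on morphisms is left adjoint to the functor $\Sigma:\mathbf{LocS}\to\mathbf{LSS}$ given by $\Sigma(L,L_s)=(Spec(L),\Delta_L(L_s))$ on objects and $\Sigma(h_* )=h_*|_{Spec(M)}:Spec(M)\to Spec(L)$ on morphisms $h_*:(M,M_s)\to(L,L_s)$.
   Context: Locally small spaces. A locally small space is a pair $(X,\mathcal{L}_X)$ where $X$ is a set and $\mathcal{L}_X\subseteq\mathcal{P}(X)$ satisfies: $\emptyset\in\mathcal{L}_X$; if $V,W\in\mathcal{L}_X$ then $V\cap W, V\cup W\in\mathcal{L}_X$; and $\bigcup\mathcal{L}_X=X$. $\mathcal{L}_X^{wo}$ denotes the family of all unions of subfamilies of $\mathcal{L}_X$; it is the smallest topology on $X$ containing $\mathcal{L}_X$. A map $f:X\to Y$ between locally small spaces $(X,\mathcal{L}_X)$ and $(Y,\mathcal{L}_Y)$ is bounded if $\mathcal{L}_X$ is a refinement of $f^{-1}(\mathcal{L}_Y)=\{f^{-1}(V):V\in\mathcal{L}_Y\}$ (every $W\in\mathcal{L}_X$ is contained in $f^{-1}(V)$ for some $V\in\mathcal{L}_Y$), and continuous if $f^{-1}(V)\cap W\in\mathcal{L}_X$ for all $V\in\mathcal{L}_Y$, $W\in\mathcal{L}_X$.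 $\mathbf{LSS}$ is the category of locally small spaces and bounded continuous maps. For a bounded continuous $f:(X,\mathcal{L}_X)\to(Y,\mathcal{L}_Y)$, let $\mathcal{L}^{wo}f:\mathcal{L}_Y^{wo}\to\mathcal{L}_X^{wo}$, $(\mathcal{L}^{wo}f)(W)=f^{-1}(W)$. Frames. A frame is a complete lattice satisfying $a\wedge\bigvee_{i}b_i=\bigvee_i(a\wedge b_i)$ for arbitrary families. A frame homomorphism is a lattice homomorphism between frames preserving all joins. For a frame homomorphism $h:L\to M$, $h_*:M\to L$ denotes its right Galois adjoint, $h_*(m)=\bigvee\{l\in L:h(l)\le m\}$. The spectrum is $Spec(L)=\{p\in L\setminus\{1\}: p=a\wedge b\Rightarrow (p=a\text{ or }p=b)\}$; for $a\in L$, $\Delta_L(a)=\{p\in Spec(L):a\not\le p\}$, and for $S\subseteq L$, $\Delta_L(S)=\{\Delta_L(a):a\in S\}$. The category $\mathbf{FrmS}$: objects are pairs $(L,L_s)$ with $L$ a frame and $L_s\subseteq L$ a sublattice containing $0$ (closed under binary meets and joins, not necessarily containing $1$) that sup-generates $L$, i.e. every element of $L$ is the supremum of a subset of $L_s$. Morphisms $h:(L,L_s)\to(M,M_s)$ are frame homomorphisms $h:L\to M$ that are dominating (for every $m\in M_s$ there is $l\in L_s$ with $h(l)\wedge m=m$) and compatible (for all $m\in M_s$, $l\in L_s$, $h(l)\wedge m\in M_s$). The category $\mathbf{LocS}$: same objects as $\mathbf{FrmS}$; morphisms $(M,M_s)\to(L,L_s)$ are the special localic maps, i.e. the right Galois adjoints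 $h_*:M\to L$ of dominating compatible frame homomorphisms $h:(L,L_s)\to(M,M_s)$; composition is composition of maps. *)

theory Defs
  imports "HOL-Algebra.Complete_Lattice" "HOL-Library.FuncSet"
begin

section \<open>Categories and functors\<close>

text \<open>
  Hom-sets are indexed by source and target, so the same HOL function may be an arrow
  between several pairs of objects. For the same reason the arrow part of a functor also
  receives the source and the target of its argument.
\<close>

record ('o, 'm) category =
  Obj :: "'o set"
  Hom :: "'o \<Rightarrow> 'o \<Rightarrow> 'm set"
  Id :: "'o \<Rightarrow> 'm"
  Cmp :: "'o \<Rightarrow> 'o \<Rightarrow> 'o \<Rightarrow> 'm \<Rightarrow> 'm \<Rightarrow> 'm"

definition is_category :: "('o, 'm) category \<Rightarrow> bool" where
  "is_category C \<longleftrightarrow>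
     (\<forall>X\<in>Obj C. Id C X \<in> Hom C X X) \<and>
     (\<forall>X\<in>Obj C. \<forall>Y\<in>Obj C. \<forall>Z\<in>Obj C. \<forall>f\<in>Hom C X Y. \<forall>g\<in>Hom C Y Z.
        Cmp C X Y Z g f \<in> Hom C X Z) \<and>
     (\<forall>X\<in>Obj C. \<forall>Y\<in>Obj C. \<forall>f\<in>Hom C X Y.
        Cmp C X X Y f (Id C X) = f \<and> Cmp C X Y Y (Id C Y) f = f) \<and>
     (\<forall>W\<in>Obj C. \<forall>X\<in>Obj C. \<forall>Y\<in>Obj C. \<forall>Z\<in>Obj C.
        \<forall>f\<in>Hom C W X. \<forall>g\<in>Hom C X Y. \<forall>h\<in>Hom C Y Z.
        Cmp C W Y Z h (Cmp C W X Y g f) = Cmp C W X Z (Cmp C X Y Z h g) f)"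

definition is_functor ::
  "('o, 'm) category \<Rightarrow> ('p, 'n) category \<Rightarrow> ('o \<Rightarrow> 'p) \<Rightarrow> ('o \<Rightarrow> 'o \<Rightarrow> 'm \<Rightarrow> 'n) \<Rightarrow> bool" where
  "is_functor C D Fo Fm \<longleftrightarrow>
     is_category C \<and> is_category D \<and>
     (\<forall>X\<in>Obj C. Fo X \<in> Obj D) \<and>
     (\<forall>X\<in>Obj C. \<forall>Y\<in>Obj C. \<forall>f\<in>Hom C X Y. Fm X Y f \<in> Hom D (Fo X) (Fo Y)) \<and>
     (\<forall>X\<in>Obj C. Fm X X (Id C X) = Id D (Fo X)) \<and>
     (\<forall>X\<in>Obj C. \<forall>Y\<in>Obj C. \<forall>Z\<in>Obj C. \<forall>f\<in>Hom C X Y. \<forall>g\<in>Hom C Y Z.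
        Fm X Z (Cmp C X Y Z g f) = Cmp D (Fo X) (Fo Y) (Fo Z) (Fm Y Z g) (Fm X Y f))"


section \<open>Locally small spaces\<close>

type_synonym 'a space = "'a set \<times> 'a set set"

definition locally_small_space :: "'a space \<Rightarrow> bool" where
  "locally_small_space X \<longleftrightarrow>
     {} \<in> snd X \<and>
     (\<forall>V\<in>snd X. \<forall>W\<in>snd X. V \<inter> W \<in> snd X \<and> V \<union> W \<in> snd X) \<and>
     \<Union>(snd X) = fst X"

definition unions :: "'a set set \<Rightarrow> 'a set set" where
  "unions \<L> = {\<Union>\<A> | \<A>. \<A> \<subseteq> \<L>}"

definition bounded_map :: "'a space \<Rightarrow> 'b space \<Rightarrow> ('a \<Rightarrow> 'b) \<Rightarrow> bool" where
  "bounded_map X Y f \<longleftrightarrow> (\<forall>W\<in>snd X. \<exists>V\<in>snd Y. W \<subseteq> f -` V \<inter> fst X)"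

definition continuous_lss_map :: "'a space \<Rightarrow> 'b space \<Rightarrow> ('a \<Rightarrow> 'b) \<Rightarrow> bool" where
  "continuous_lss_map X Y f \<longleftrightarrow>
     (\<forall>V\<in>snd Y. \<forall>W\<in>snd X. (f -` V \<inter> fst X) \<inter> W \<in> snd X)"

text \<open>
  Maps between carrier sets are extensional functions, so equality of arrows is HOL
  equality. The hom-sets are defined for spaces over two different types.
\<close>

definition LSS_hom :: "'a space \<Rightarrow> 'b space \<Rightarrow> ('a \<Rightarrow> 'b) set" where
  "LSS_hom X Y = {f \<in> fst X \<rightarrow>\<^sub>E fst Y. bounded_map X Y f \<and> continuous_lss_map X Y f}"

definition LSS :: "('a space, 'a \<Rightarrow> 'a) category" where
  "LSS = \<lparr> Obj = {X. locally_small_space X},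
           Hom = LSS_hom,
           Id = (\<lambda>X. restrict id (fst X)),
           Cmp = (\<lambda>X Y Z g f. compose (fst X) g f) \<rparr>"


section \<open>Frames and localic maps\<close>

locale frame = complete_lattice L for L (structure) +
  assumes meet_Sup_distrib:
    "\<lbrakk>a \<in> carrier L; B \<subseteq> carrier L\<rbrakk> \<Longrightarrow> a \<sqinter> \<Squnion>B = \<Squnion>((\<lambda>b. a \<sqinter> b) ` B)"

text \<open>
  A lattice homomorphism is only required to preserve binary meets and joins. For dominating
  homomorphisms, the only ones used below, preservation of the top element follows.
\<close>

definition frame_hom :: "'a gorder \<Rightarrow> 'b gorder \<Rightarrow> ('a \<Rightarrow> 'b) \<Rightarrow> bool" where
  "frame_hom L M h \<longleftrightarrow>
     h \<in> carrier L \<rightarrow>\<^sub>E carrier M \<and>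
     (\<forall>a\<in>carrier L. \<forall>b\<in>carrier L. h (a \<sqinter>\<^bsub>L\<^esub> b) = h a \<sqinter>\<^bsub>M\<^esub> h b) \<and>
     (\<forall>a\<in>carrier L. \<forall>b\<in>carrier L. h (a \<squnion>\<^bsub>L\<^esub> b) = h a \<squnion>\<^bsub>M\<^esub> h b) \<and>
     (\<forall>A\<subseteq>carrier L. h (\<Squnion>\<^bsub>L\<^esub>A) = \<Squnion>\<^bsub>M\<^esub>(h ` A))"

definition right_adj :: "'a gorder \<Rightarrow> 'b gorder \<Rightarrow> ('a \<Rightarrow> 'b) \<Rightarrow> 'b \<Rightarrow> 'a" where
  "right_adj L M h = (\<lambda>m\<in>carrier M. \<Squnion>\<^bsub>L\<^esub>{l \<in> carrier L. h l \<sqsubseteq>\<^bsub>M\<^esub> m})"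

definition Spec :: "'a gorder \<Rightarrow> 'a set" where
  "Spec L = {p \<in> carrier L - {\<top>\<^bsub>L\<^esub>}.
     \<forall>a\<in>carrier L. \<forall>b\<in>carrier L. p = a \<sqinter>\<^bsub>L\<^esub> b \<longrightarrow> p = a \<or> p = b}"

definition Delta :: "'a gorder \<Rightarrow> 'a \<Rightarrow> 'a set" where
  "Delta L a = {p \<in> Spec L. \<not> a \<sqsubseteq>\<^bsub>L\<^esub> p}"

type_synonym 'a sframe = "'a gorder \<times> 'a set"

definition special_frame :: "'a sframe \<Rightarrow> bool" where
  "special_frame A \<longleftrightarrow> (case A of (L, Ls) \<Rightarrow>
     frame L \<and> Ls \<subseteq> carrier L \<and> \<bottom>\<^bsub>L\<^esub> \<in> Ls \<and>
     (\<forall>a\<in>Ls. \<forall>b\<in>Ls. a \<sqinter>\<^bsub>L\<^esub> b \<in> Ls \<and> a \<squnion>\<^bsub>L\<^esub> b \<in> Ls) \<and>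
     (\<forall>x\<in>carrier L. \<exists>S\<subseteq>Ls. x = \<Squnion>\<^bsub>L\<^esub>S))"

definition dominating :: "'a sframe \<Rightarrow> 'b sframe \<Rightarrow> ('a \<Rightarrow> 'b) \<Rightarrow> bool" where
  "dominating A B h \<longleftrightarrow> (\<forall>m\<in>snd B. \<exists>l\<in>snd A. h l \<sqinter>\<^bsub>fst B\<^esub> m = m)"

definition compatible :: "'a sframe \<Rightarrow> 'b sframe \<Rightarrow> ('a \<Rightarrow> 'b) \<Rightarrow> bool" where
  "compatible A B h \<longleftrightarrow> (\<forall>m\<in>snd B. \<forall>l\<in>snd A. h l \<sqinter>\<^bsub>fst B\<^esub> m \<in> snd B)"

definition FrmS_hom :: "'a sframe \<Rightarrow> 'b sframe \<Rightarrow> ('a \<Rightarrow> 'b) set" where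
  "FrmS_hom A B = {h. frame_hom (fst A) (fst B) h \<and> dominating A B h \<and> compatible A B h}"

definition LocS_hom :: "'b sframe \<Rightarrow> 'a sframe \<Rightarrow> ('b \<Rightarrow> 'a) set" where
  "LocS_hom B A = right_adj (fst A) (fst B) ` FrmS_hom A B"

definition LocS :: "('a sframe, 'a \<Rightarrow> 'a) category" where
  "LocS = \<lparr> Obj = {A. special_frame A},
            Hom = LocS_hom,
            Id = (\<lambda>A. restrict id (carrier (fst A))),
            Cmp = (\<lambda>A B C g f. compose (carrier (fst A)) g f) \<rparr>"


section \<open>The functors\<close>

definition open_frame :: "'a space \<Rightarrow> 'a set gorder" where
  "open_frame X = \<lparr> carrier = unions (snd X), eq = (=), le = (\<subseteq>) \<rparr>"

definition preimage_hom :: "'a space \<Rightarrow> 'b space \<Rightarrow> ('a \<Rightarrow> 'b) \<Rightarrow> 'b set \<Rightarrow> 'a set" where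
  "preimage_hom X Y f = (\<lambda>W\<in>unions (snd Y). f -` W \<inter> fst X)"

definition Omega :: "'a space \<Rightarrow> 'a set sframe" where
  "Omega X = (open_frame X, snd X)"

definition Omega_map :: "'a space \<Rightarrow> 'b space \<Rightarrow> ('a \<Rightarrow> 'b) \<Rightarrow> 'a set \<Rightarrow> 'b set" where
  "Omega_map X Y f = right_adj (open_frame Y) (open_frame X) (preimage_hom X Y f)"

definition Sigma_obj :: "'a sframe \<Rightarrow> 'a space" where
  "Sigma_obj A = (Spec (fst A), Delta (fst A) ` snd A)"

definition Sigma_map :: "'b sframe \<Rightarrow> 'a sframe \<Rightarrow> ('b \<Rightarrow> 'a) \<Rightarrow> 'b \<Rightarrow> 'a" where
  "Sigma_map B A k = restrict k (Spec (fst B))"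

end

theory Submission
  imports Defs
begin

text \<open>
  The unit of the adjunction sends a point \<open>x\<close> of a locally small space \<open>X\<close> to the complement of the
  closure of \<open>x\<close>, the largest weakly open set that misses \<open>x\<close> (\<open>point_prime\<close>). It is a prime of
  the frame of weakly open sets, because an intersection misses \<open>x\<close> only if one of the two sets does.
  The hom-set bijection (\<open>spatial_transpose\<close>) composes a special localic map \<open>h\<^sub>*\<close> with the unit.

  Everything rests on one equivalence (\<open>le_transpose_iff\<close>): for a special homomorphism \<open>h\<close> from
  \<open>L\<close> to the weakly open sets of \<open>X\<close>, an element \<open>l\<close> lies below \<open>h\<^sub>*\<close> of the prime of \<open>x\<close> if and only
  if \<open>x\<close> is not in \<open>h l\<close>. In other words, the preimage of \<open>\<Delta> l\<close> under the transpose \<open>f\<close> of \<open>h\<^sub>*\<close> is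
  \<open>h l\<close>. So \<open>f\<close> determines \<open>h\<close> and hence \<open>h\<^sub>*\<close>; boundedness and continuity of \<open>f\<close> are
  domination and compatibility of \<open>h\<close>; and conversely every bounded continuous \<open>f\<close> into the
  spectrum arises from the homomorphism \<open>l \<mapsto> f -` \<Delta> l\<close> (\<open>transpose_spectral_preimage\<close>).
  Naturality holds because \<open>(L\<^sup>w\<^sup>o f)\<^sub>*\<close> carries the prime of \<open>x\<close> to the prime of \<open>f x\<close>
  (\<open>Omega_map_point_prime\<close>).

  Functoriality is obtained from the Galois connection \<open>l \<sqsubseteq> h\<^sub>* m \<longleftrightarrow> h l \<sqsubseteq> m\<close>
  (\<open>le_right_adj_iff\<close>). It shows that adjoints compose contravariantly, that \<open>h\<^sub>*\<close> preserves
  primes, and that the preimage of \<open>\<Delta> l\<close> under the restriction of \<open>h\<^sub>*\<close> to primes is \<open>\<Delta> (h l)\<close>.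
\<close>

section \<open>Frames and primes\<close>

context frame
begin

lemma Sup_le_iff:
  assumes "B \<subseteq> carrier L" "z \<in> carrier L"
  shows "\<Squnion>B \<sqsubseteq> z \<longleftrightarrow> (\<forall>b\<in>B. b \<sqsubseteq> z)"
  using assms by (meson le_trans subsetD sup_closed sup_least sup_upper)

lemma le_meet_iff:
  assumes "a \<in> carrier L" "b \<in> carrier L" "c \<in> carrier L"
  shows "c \<sqsubseteq> a \<sqinter> b \<longleftrightarrow> c \<sqsubseteq> a \<and> c \<sqsubseteq> b"
  using assms by (meson le_trans meet_closed meet_le meet_left meet_right)

lemma meet_absorb_iff:
  assumes "a \<in> carrier L" "b \<in> carrier L"
  shows "a \<sqinter> b = b \<longleftrightarrow> b \<sqsubseteq> a"
proof
  assume "a \<sqinter> b = b"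
  then show "b \<sqsubseteq> a" using meet_left[OF assms] by simp
next
  assume "b \<sqsubseteq> a"
  then show "a \<sqinter> b = b"
    using assms by (intro le_antisym) (auto simp: le_meet_iff meet_right)
qed

lemma join_le_iff:
  assumes "a \<in> carrier L" "b \<in> carrier L" "c \<in> carrier L"
  shows "a \<squnion> b \<sqsubseteq> c \<longleftrightarrow> a \<sqsubseteq> c \<and> b \<sqsubseteq> c"
  using assms by (meson le_trans join_closed join_le join_left join_right)

lemma eqI_below:
  assumes "a \<in> carrier L" "b \<in> carrier L" "\<And>c. c \<in> carrier L \<Longrightarrow> c \<sqsubseteq> a \<longleftrightarrow> c \<sqsubseteq> b"
  shows "a = b"
  using assms by (meson le_antisym le_refl)

lemma join_meet_distrib:
  assumes "a \<in> carrier L" "b \<in> carrier L" "c \<in> carrier L"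
  shows "a \<sqinter> (b \<squnion> c) = (a \<sqinter> b) \<squnion> (a \<sqinter> c)"
  using meet_Sup_distrib[of a "{b, c}"] assms by (simp add: join_def)

end

context
  fixes L :: "'a gorder" (structure)
  assumes frame: "frame L"
begin

interpretation frame L by (rule frame)

lemma SpecD:
  assumes "p \<in> Spec L"
  shows "p \<in> carrier L" "\<not> \<top> \<sqsubseteq> p"
  using assms le_antisym[OF _ top_higher] unfolding Spec_def by auto

text \<open>
  If \<open>a \<sqinter> b \<sqsubseteq> p\<close>, distributivity yields \<open>p = (p \<squnion> a) \<sqinter> (p \<squnion> b)\<close>. Thus the
  meet-irreducible elements of a frame are exactly its prime elements.
\<close>

lemma Spec_iff_prime:
  "p \<in> Spec L \<longleftrightarrow> p \<in> carrier L \<and> \<not> \<top> \<sqsubseteq> p \<and>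
     (\<forall>a\<in>carrier L. \<forall>b\<in>carrier L. a \<sqinter> b \<sqsubseteq> p \<longrightarrow> a \<sqsubseteq> p \<or> b \<sqsubseteq> p)"
proof
  assume p: "p \<in> Spec L"
  note pc = SpecD[OF p]
  have "a \<sqsubseteq> p \<or> b \<sqsubseteq> p" if a: "a \<in> carrier L" and b: "b \<in> carrier L" and ab: "a \<sqinter> b \<sqsubseteq> p" for a b
  proof -
    have "(p \<squnion> a) \<sqinter> (p \<squnion> b) = ((p \<squnion> a) \<sqinter> p) \<squnion> ((p \<squnion> a) \<sqinter> b)"
      using pc a b by (simp add: join_meet_distrib)
    also have "(p \<squnion> a) \<sqinter> b = (b \<sqinter> p) \<squnion> (b \<sqinter> a)"
      using pc a b by (metis join_meet_distrib meet_comm)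
    finally have eq: "(p \<squnion> a) \<sqinter> (p \<squnion> b) = ((p \<squnion> a) \<sqinter> p) \<squnion> ((b \<sqinter> p) \<squnion> (b \<sqinter> a))" .
    have "(p \<squnion> a) \<sqinter> (p \<squnion> b) \<sqsubseteq> p"
      unfolding eq using pc a b ab by (simp add: join_le_iff meet_right meet_comm[of L b a])
    moreover have "p \<sqsubseteq> (p \<squnion> a) \<sqinter> (p \<squnion> b)"
      using pc a b by (simp add: le_meet_iff join_left)
    ultimately have "p = (p \<squnion> a) \<sqinter> (p \<squnion> b)"
      using pc a b by (meson join_closed le_antisym meet_closed)
    then have "p = p \<squnion> a \<or> p = p \<squnion> b"
      using p a b pc unfolding Spec_def by (smt (verit, best) join_closed mem_Collect_eq)
    then show ?thesis
      using pc a b by (metis join_right)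
  qed
  with pc show "p \<in> carrier L \<and> \<not> \<top> \<sqsubseteq> p \<and>
     (\<forall>a\<in>carrier L. \<forall>b\<in>carrier L. a \<sqinter> b \<sqsubseteq> p \<longrightarrow> a \<sqsubseteq> p \<or> b \<sqsubseteq> p)" by blast
next
  assume *: "p \<in> carrier L \<and> \<not> \<top> \<sqsubseteq> p \<and>
     (\<forall>a\<in>carrier L. \<forall>b\<in>carrier L. a \<sqinter> b \<sqsubseteq> p \<longrightarrow> a \<sqsubseteq> p \<or> b \<sqsubseteq> p)"
  then have "p = a \<or> p = b" if "a \<in> carrier L" "b \<in> carrier L" "p = a \<sqinter> b" for a b
    using that by (metis le_antisym le_refl meet_left meet_right)
  then show "p \<in> Spec L"
    using * unfolding Spec_def by auto
qed

lemma Delta_meet: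
  assumes "a \<in> carrier L" "b \<in> carrier L"
  shows "Delta L (a \<sqinter> b) = Delta L a \<inter> Delta L b"
  using assms unfolding Delta_def by (auto simp: Spec_iff_prime) (meson le_trans meet_closed meet_left meet_right)+

lemma Delta_join:
  assumes "a \<in> carrier L" "b \<in> carrier L"
  shows "Delta L (a \<squnion> b) = Delta L a \<union> Delta L b"
  using assms unfolding Delta_def by (auto simp: Spec_iff_prime join_le_iff)

lemma Delta_Sup:
  assumes "B \<subseteq> carrier L"
  shows "Delta L (\<Squnion>B) = \<Union>(Delta L ` B)"
  using assms unfolding Delta_def by (auto simp: Spec_iff_prime Sup_le_iff)

lemma Delta_bottom: "Delta L \<bottom> = {}"
  unfolding Delta_def by (auto simp: Spec_iff_prime)

end


section \<open>Frame homomorphisms and their right adjoints\<close>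

lemma frame_homD:
  assumes "frame_hom L M h"
  shows "h \<in> extensional (carrier L)"
    and "a \<in> carrier L \<Longrightarrow> h a \<in> carrier M"
    and "\<lbrakk>a \<in> carrier L; b \<in> carrier L\<rbrakk> \<Longrightarrow> h (a \<sqinter>\<^bsub>L\<^esub> b) = h a \<sqinter>\<^bsub>M\<^esub> h b"
    and "\<lbrakk>a \<in> carrier L; b \<in> carrier L\<rbrakk> \<Longrightarrow> h (a \<squnion>\<^bsub>L\<^esub> b) = h a \<squnion>\<^bsub>M\<^esub> h b"
    and "A \<subseteq> carrier L \<Longrightarrow> h (\<Squnion>\<^bsub>L\<^esub>A) = \<Squnion>\<^bsub>M\<^esub>(h ` A)"
  using assms unfolding frame_hom_def by (auto simp: PiE_iff)

lemma frame_hom_mono: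
  assumes L: "frame L" and M: "frame M" and h: "frame_hom L M h"
    and "a \<in> carrier L" "b \<in> carrier L" "a \<sqsubseteq>\<^bsub>L\<^esub> b"
  shows "h a \<sqsubseteq>\<^bsub>M\<^esub> h b"
proof -
  interpret L: frame L by fact
  interpret M: frame M by fact
  have "a \<squnion>\<^bsub>L\<^esub> b = b"
    using assms by (meson L.join_closed L.join_le L.join_right L.le_antisym L.le_refl)
  then show ?thesis
    using frame_homD[OF h] assms(4,5) by (metis M.join_left)
qed

lemma right_adj_closed:
  assumes "frame L" "m \<in> carrier M"
  shows "right_adj L M h m \<in> carrier L"
proof -
  interpret L: frame L by fact
  show ?thesis using assms(2) by (simp add: right_adj_def)
qed

text \<open>
  The Galois connection: the join defining the adjoint is itself sent below \<open>m\<close>, because \<open>h\<close>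
  preserves joins.
\<close>

lemma le_right_adj_iff:
  assumes L: "frame L" and M: "frame M" and h: "frame_hom L M h"
    and l: "l \<in> carrier L" and m: "m \<in> carrier M"
  shows "l \<sqsubseteq>\<^bsub>L\<^esub> right_adj L M h m \<longleftrightarrow> h l \<sqsubseteq>\<^bsub>M\<^esub> m"
proof -
  interpret L: frame L by fact
  interpret M: frame M by fact
  let ?S = "{l \<in> carrier L. h l \<sqsubseteq>\<^bsub>M\<^esub> m}"
  have S: "?S \<subseteq> carrier L" by auto
  have r: "right_adj L M h m = \<Squnion>\<^bsub>L\<^esub>?S" using m by (simp add: right_adj_def)
  have "h (\<Squnion>\<^bsub>L\<^esub>?S) \<sqsubseteq>\<^bsub>M\<^esub> m"
    unfolding frame_homD(5)[OF h S]
    by (rule M.sup_least) (use frame_homD(2)[OF h] m in auto)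
  moreover have "h l \<sqsubseteq>\<^bsub>M\<^esub> h (\<Squnion>\<^bsub>L\<^esub>?S)" if "l \<sqsubseteq>\<^bsub>L\<^esub> \<Squnion>\<^bsub>L\<^esub>?S"
    using frame_hom_mono[OF L M h l _ that] S by simp
  ultimately have "h l \<sqsubseteq>\<^bsub>M\<^esub> m" if "l \<sqsubseteq>\<^bsub>L\<^esub> \<Squnion>\<^bsub>L\<^esub>?S"
    using that S l m frame_homD(2)[OF h] by (meson L.sup_closed M.le_trans)
  moreover have "l \<sqsubseteq>\<^bsub>L\<^esub> \<Squnion>\<^bsub>L\<^esub>?S" if "h l \<sqsubseteq>\<^bsub>M\<^esub> m"
    using that l by (intro L.sup_upper) auto
  ultimately show ?thesis unfolding r by blast
qed

lemma frame_hom_id: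
  assumes "frame L"
  shows "frame_hom L L (restrict id (carrier L))"
proof -
  interpret L: frame L by fact
  have "restrict id (carrier L) ` A = A" if "A \<subseteq> carrier L" for A
    using that by (auto simp: image_iff)
  then show ?thesis
    unfolding frame_hom_def by auto
qed

lemma frame_hom_compose:
  assumes "frame L" "frame M" and h: "frame_hom L M h" and k: "frame_hom M N k"
  shows "frame_hom L N (compose (carrier L) k h)"
proof -
  interpret L: frame L by fact
  interpret M: frame M by fact
  note hD = frame_homD[OF h] and kD = frame_homD[OF k]
  have "compose (carrier L) k h (\<Squnion>\<^bsub>L\<^esub>A) = \<Squnion>\<^bsub>N\<^esub>(compose (carrier L) k h ` A)"
    if A: "A \<subseteq> carrier L" for A
  proof -
    have "compose (carrier L) k h ` A = k ` h ` A"
      using A by (auto simp: compose_def image_iff subset_iff)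
    moreover have "h ` A \<subseteq> carrier M" using A hD(2) by auto
    ultimately show ?thesis
      using A by (simp add: compose_eq hD(5) kD(5))
  qed
  moreover have "compose (carrier L) k h \<in> carrier L \<rightarrow>\<^sub>E carrier N"
    by (auto simp: PiE_iff compose_eq hD(2) kD(2))
  ultimately show ?thesis
    unfolding frame_hom_def by (simp add: compose_eq hD(2-4) kD(2-4))
qed

lemma right_adj_id:
  assumes "frame L"
  shows "right_adj L L (restrict id (carrier L)) = restrict id (carrier L)"
proof
  interpret L: frame L by fact
  fix m
  show "right_adj L L (restrict id (carrier L)) m = restrict id (carrier L) m"
  proof (cases "m \<in> carrier L")
    case True
    have "right_adj L L (restrict id (carrier L)) m = m"
      using True assms
      by (intro L.eqI_below) (auto simp: right_adj_closed le_right_adj_iff frame_hom_id)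
    with True show ?thesis by simp
  qed (simp add: right_adj_def)
qed

lemma right_adj_compose:
  assumes L: "frame L" and M: "frame M" and N: "frame N"
    and h: "frame_hom L M h" and k: "frame_hom M N k"
  shows "right_adj L N (compose (carrier L) k h)
       = compose (carrier N) (right_adj L M h) (right_adj M N k)"
proof
  interpret L: frame L by fact
  fix n
  show "right_adj L N (compose (carrier L) k h) n
      = compose (carrier N) (right_adj L M h) (right_adj M N k) n"
  proof (cases "n \<in> carrier N")
    case True
    have hk: "frame_hom L N (compose (carrier L) k h)"
      by (rule frame_hom_compose[OF L M h k])
    show ?thesis
      using True
      by (intro L.eqI_below)
        (auto simp: compose_eq right_adj_closed L M le_right_adj_iff[OF L N hk]
          le_right_adj_iff[OF L M h] le_right_adj_iff[OF M N k] frame_homD(2)[OF h])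
  qed (simp add: right_adj_def compose_def)
qed


section \<open>Special frames\<close>

lemma special_frameD:
  assumes "special_frame A"
  shows "frame (fst A)" "snd A \<subseteq> carrier (fst A)" "\<bottom>\<^bsub>fst A\<^esub> \<in> snd A"
    and "\<lbrakk>a \<in> snd A; b \<in> snd A\<rbrakk> \<Longrightarrow> a \<sqinter>\<^bsub>fst A\<^esub> b \<in> snd A"
    and "\<lbrakk>a \<in> snd A; b \<in> snd A\<rbrakk> \<Longrightarrow> a \<squnion>\<^bsub>fst A\<^esub> b \<in> snd A"
    and "x \<in> carrier (fst A) \<Longrightarrow> \<exists>S\<subseteq>snd A. x = \<Squnion>\<^bsub>fst A\<^esub>S"
  using assms by (auto simp: special_frame_def split: prod.splits)

lemma special_frame_le_iff:
  assumes A: "special_frame A" and x: "x \<in> carrier (fst A)" and y: "y \<in> carrier (fst A)"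
  shows "x \<sqsubseteq>\<^bsub>fst A\<^esub> y \<longleftrightarrow> (\<forall>l\<in>snd A. l \<sqsubseteq>\<^bsub>fst A\<^esub> x \<longrightarrow> l \<sqsubseteq>\<^bsub>fst A\<^esub> y)"
proof -
  interpret L: frame "fst A" by (rule special_frameD(1)[OF A])
  note s = special_frameD(2)[OF A]
  obtain S where S: "S \<subseteq> snd A" "x = \<Squnion>\<^bsub>fst A\<^esub>S" using special_frameD(6)[OF A x] by blast
  have "x \<sqsubseteq>\<^bsub>fst A\<^esub> y" if *: "\<forall>l\<in>snd A. l \<sqsubseteq>\<^bsub>fst A\<^esub> x \<longrightarrow> l \<sqsubseteq>\<^bsub>fst A\<^esub> y"
    unfolding S(2)
  proof (rule L.sup_least)
    fix l assume "l \<in> S"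
    then show "l \<sqsubseteq>\<^bsub>fst A\<^esub> y" using * S s L.sup_upper[of S l] by blast
  qed (use S s y in auto)
  then show ?thesis using s x y by (meson L.le_trans subsetD)
qed

lemma dominating_iff:
  assumes "frame (fst B)" "\<And>l. l \<in> snd A \<Longrightarrow> h l \<in> carrier (fst B)" "snd B \<subseteq> carrier (fst B)"
  shows "dominating A B h \<longleftrightarrow> (\<forall>m\<in>snd B. \<exists>l\<in>snd A. m \<sqsubseteq>\<^bsub>fst B\<^esub> h l)"
proof -
  interpret frame "fst B" by fact
  have "h l \<sqinter>\<^bsub>fst B\<^esub> m = m \<longleftrightarrow> m \<sqsubseteq>\<^bsub>fst B\<^esub> h l" if "m \<in> snd B" "l \<in> snd A" for m l
    using assms(2)[OF that(2)] subsetD[OF assms(3) that(1)] by (rule meet_absorb_iff)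
  then show ?thesis unfolding dominating_def by simp
qed

lemma FrmS_homD:
  assumes A: "special_frame A" and B: "special_frame B" and h: "h \<in> FrmS_hom A B"
  shows "frame_hom (fst A) (fst B) h"
    and "m \<in> snd B \<Longrightarrow> \<exists>l\<in>snd A. m \<sqsubseteq>\<^bsub>fst B\<^esub> h l"
    and "\<lbrakk>m \<in> snd B; l \<in> snd A\<rbrakk> \<Longrightarrow> h l \<sqinter>\<^bsub>fst B\<^esub> m \<in> snd B"
proof -
  show fh: "frame_hom (fst A) (fst B) h" using h by (simp add: FrmS_hom_def)
  have "dominating A B h" using h by (simp add: FrmS_hom_def)
  then show "\<exists>l\<in>snd A. m \<sqsubseteq>\<^bsub>fst B\<^esub> h l" if "m \<in> snd B"
    using that dominating_iff[OF special_frameD(1)[OF B] _ special_frameD(2)[OF B], of A h]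
      frame_homD(2)[OF fh] subsetD[OF special_frameD(2)[OF A]] by blast
  show "h l \<sqinter>\<^bsub>fst B\<^esub> m \<in> snd B" if "m \<in> snd B" "l \<in> snd A"
    using h that by (auto simp: FrmS_hom_def compatible_def)
qed

lemma FrmS_homI:
  assumes A: "special_frame A" and B: "special_frame B" and fh: "frame_hom (fst A) (fst B) h"
    and "\<And>m. m \<in> snd B \<Longrightarrow> \<exists>l\<in>snd A. m \<sqsubseteq>\<^bsub>fst B\<^esub> h l"
    and "\<And>m l. \<lbrakk>m \<in> snd B; l \<in> snd A\<rbrakk> \<Longrightarrow> h l \<sqinter>\<^bsub>fst B\<^esub> m \<in> snd B"
  shows "h \<in> FrmS_hom A B"
proof -
  have "dominating A B h"
    using assms(4) dominating_iff[OF special_frameD(1)[OF B] _ special_frameD(2)[OF B], of A h]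
      frame_homD(2)[OF fh] subsetD[OF special_frameD(2)[OF A]] by blast
  then show ?thesis using assms by (auto simp: FrmS_hom_def compatible_def)
qed

text \<open>
  The top of the target is the join of its distinguished elements, and each of these lies below
  the image of some element.
\<close>

lemma FrmS_hom_top:
  assumes A: "special_frame A" and B: "special_frame B" and h: "h \<in> FrmS_hom A B"
  shows "h \<top>\<^bsub>fst A\<^esub> = \<top>\<^bsub>fst B\<^esub>"
proof -
  interpret L: frame "fst A" by (rule special_frameD(1)[OF A])
  interpret M: frame "fst B" by (rule special_frameD(1)[OF B])
  note hD = FrmS_homD[OF A B h]
  have c: "h \<top>\<^bsub>fst A\<^esub> \<in> carrier (fst B)" by (simp add: frame_homD(2)[OF hD(1)])
  have "\<top>\<^bsub>fst B\<^esub> \<sqsubseteq>\<^bsub>fst B\<^esub> h \<top>\<^bsub>fst A\<^esub>"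
    unfolding special_frame_le_iff[OF B M.top_closed c]
  proof safe
    fix m assume m: "m \<in> snd B"
    obtain l where l: "l \<in> snd A" "m \<sqsubseteq>\<^bsub>fst B\<^esub> h l" using hD(2)[OF m] by blast
    then have lc: "l \<in> carrier (fst A)" using special_frameD(2)[OF A] by auto
    have "h l \<sqsubseteq>\<^bsub>fst B\<^esub> h \<top>\<^bsub>fst A\<^esub>"
      using lc by (intro frame_hom_mono[OF L.frame_axioms M.frame_axioms hD(1)])
        (auto simp: L.top_higher)
    then show "m \<sqsubseteq>\<^bsub>fst B\<^esub> h \<top>\<^bsub>fst A\<^esub>"
      using l lc m c special_frameD(2)[OF B] frame_homD(2)[OF hD(1)] by (meson M.le_trans subsetD)
  qed
  then show ?thesis using c by (meson M.le_antisym M.top_closed M.top_higher)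
qed

lemma FrmS_hom_id:
  assumes A: "special_frame A"
  shows "restrict id (carrier (fst A)) \<in> FrmS_hom A A"
proof -
  interpret L: frame "fst A" by (rule special_frameD(1)[OF A])
  note s = special_frameD[OF A]
  show ?thesis
  proof (rule FrmS_homI[OF A A frame_hom_id[OF s(1)]])
    fix m assume m: "m \<in> snd A"
    then show "\<exists>l\<in>snd A. m \<sqsubseteq>\<^bsub>fst A\<^esub> restrict id (carrier (fst A)) l"
      using s(2) by (intro bexI[of _ m]) auto
    show "restrict id (carrier (fst A)) l \<sqinter>\<^bsub>fst A\<^esub> m \<in> snd A" if "l \<in> snd A" for l
      using s(2) s(4)[OF that m] that by (auto simp: subset_iff)
  qed
qed

text \<open>
  For compatibility of \<open>k \<circ> h\<close>, an element \<open>n\<close> of \<open>C\<^sub>s\<close> is bounded by some \<open>k m\<close>, and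
  \<open>k (h l) \<sqinter> n = k (h l \<sqinter> m) \<sqinter> n\<close>, where \<open>h l \<sqinter> m\<close> lies in \<open>B\<^sub>s\<close> although \<open>h l\<close> need not.
\<close>

lemma FrmS_hom_compose:
  assumes A: "special_frame A" and B: "special_frame B" and C: "special_frame C"
    and h: "h \<in> FrmS_hom A B" and k: "k \<in> FrmS_hom B C"
  shows "compose (carrier (fst A)) k h \<in> FrmS_hom A C"
proof -
  interpret L: frame "fst A" by (rule special_frameD(1)[OF A])
  interpret M: frame "fst B" by (rule special_frameD(1)[OF B])
  interpret N: frame "fst C" by (rule special_frameD(1)[OF C])
  note hD = FrmS_homD[OF A B h] and kD = FrmS_homD[OF B C k]
  note hF = frame_homD[OF hD(1)] and kF = frame_homD[OF kD(1)]
  note As = subsetD[OF special_frameD(2)[OF A]] and Bs = subsetD[OF special_frameD(2)[OF B]]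
    and Cs = subsetD[OF special_frameD(2)[OF C]]
  show ?thesis
  proof (rule FrmS_homI[OF A C frame_hom_compose[OF L.frame_axioms M.frame_axioms hD(1) kD(1)]])
    fix n assume n: "n \<in> snd C"
    obtain m where m: "m \<in> snd B" "n \<sqsubseteq>\<^bsub>fst C\<^esub> k m" using kD(2)[OF n] by blast
    obtain l where l: "l \<in> snd A" "m \<sqsubseteq>\<^bsub>fst B\<^esub> h l" using hD(2)[OF m(1)] by blast
    have "k m \<sqsubseteq>\<^bsub>fst C\<^esub> k (h l)"
      using l m by (intro frame_hom_mono[OF M.frame_axioms N.frame_axioms kD(1)]) (auto intro: Bs As hF)
    then have "n \<sqsubseteq>\<^bsub>fst C\<^esub> k (h l)"
      using m n l by (meson N.le_trans As Bs Cs hF(2) kF(2))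
    with l show "\<exists>l\<in>snd A. n \<sqsubseteq>\<^bsub>fst C\<^esub> compose (carrier (fst A)) k h l"
      by (auto simp: compose_eq As)
  next
    fix n l assume n: "n \<in> snd C" and l: "l \<in> snd A"
    obtain m where m: "m \<in> snd B" "n \<sqsubseteq>\<^bsub>fst C\<^esub> k m" using kD(2)[OF n] by blast
    have carr: "h l \<in> carrier (fst B)" "m \<in> carrier (fst B)" "k m \<in> carrier (fst C)"
      "k (h l) \<in> carrier (fst C)" "n \<in> carrier (fst C)"
      using l m n As Bs Cs hF(2) kF(2) by auto
    have "k (h l) \<sqinter>\<^bsub>fst C\<^esub> n = k (h l \<sqinter>\<^bsub>fst B\<^esub> m) \<sqinter>\<^bsub>fst C\<^esub> n"
      using carr m(2) by (intro N.eqI_below) (auto simp: kF(3) N.le_meet_iff intro: N.le_trans)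
    also have "\<dots> \<in> snd C" using kD(3)[OF n] hD(3)[OF m(1) l] by simp
    finally show "compose (carrier (fst A)) k h l \<sqinter>\<^bsub>fst C\<^esub> n \<in> snd C"
      using l by (simp add: compose_eq As)
  qed
qed

lemma LocS_homE:
  assumes "k \<in> LocS_hom B A"
  obtains h where "h \<in> FrmS_hom A B" "k = right_adj (fst A) (fst B) h"
  using assms unfolding LocS_hom_def by blast

lemma LocS_hom_extensional: "k \<in> LocS_hom B A \<Longrightarrow> k \<in> extensional (carrier (fst B))"
  unfolding LocS_hom_def right_adj_def by auto

lemma LocS_hom_closed:
  assumes "special_frame A" "k \<in> LocS_hom B A" "m \<in> carrier (fst B)"
  shows "k m \<in> carrier (fst A)"
  using assms right_adj_closed[OF special_frameD(1)] by (metis LocS_homE)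

lemma LocS_hom_id:
  assumes A: "special_frame A"
  shows "restrict id (carrier (fst A)) \<in> LocS_hom A A"
  unfolding LocS_hom_def
  using right_adj_id[OF special_frameD(1)[OF A]] FrmS_hom_id[OF A] by (metis imageI)

lemma LocS_hom_compose:
  assumes A: "special_frame A" and B: "special_frame B" and C: "special_frame C"
    and f: "f \<in> LocS_hom A B" and g: "g \<in> LocS_hom B C"
  shows "compose (carrier (fst A)) g f \<in> LocS_hom A C"
proof -
  obtain h where h: "h \<in> FrmS_hom B A" "f = right_adj (fst B) (fst A) h"
    using f by (rule LocS_homE)
  obtain k where k: "k \<in> FrmS_hom C B" "g = right_adj (fst C) (fst B) k"
    using g by (rule LocS_homE)
  have "compose (carrier (fst A)) g f = right_adj (fst C) (fst A) (compose (carrier (fst C)) h k)"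
    unfolding h(2) k(2)
    by (intro right_adj_compose[symmetric] special_frameD(1) A B C
        FrmS_homD(1)[OF C B k(1)] FrmS_homD(1)[OF B A h(1)])
  then show ?thesis
    unfolding LocS_hom_def using FrmS_hom_compose[OF C B A k(1) h(1)] by simp
qed

lemma compose_restrict_id:
  assumes "f \<in> extensional S" "\<And>x. x \<in> S \<Longrightarrow> f x \<in> T"
  shows "compose S f (restrict id S) = f" "compose S (restrict id T) f = f"
proof -
  show "compose S f (restrict id S) = f"
    by (rule extensionalityI[OF compose_extensional assms(1)]) (simp add: compose_eq)
  show "compose S (restrict id T) f = f"
    by (rule extensionalityI[OF compose_extensional assms(1)]) (simp add: compose_eq assms(2))
qed

lemma compose_compose:
  assumes "\<And>x. x \<in> S \<Longrightarrow> f x \<in> T"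
  shows "compose S h (compose S g f) = compose S (compose T h g) f"
  using assms by (auto simp: compose_def fun_eq_iff)

lemma LocS_is_category: "is_category LocS"
  unfolding is_category_def LocS_def category.simps
proof (intro conjI ballI; (unfold mem_Collect_eq)?)
  fix A B :: "'a sframe" and f
  assume A: "special_frame A" and B: "special_frame B" and f: "f \<in> LocS_hom A B"
  note c = LocS_hom_extensional[OF f] LocS_hom_closed[OF B f]
  show "compose (carrier (fst A)) f (restrict id (carrier (fst A))) = f"
    and "compose (carrier (fst A)) (restrict id (carrier (fst B))) f = f"
    by (rule compose_restrict_id[OF c], assumption)+
next
  fix A B C D :: "'a sframe" and f g h
  assume B: "special_frame B" and f: "f \<in> LocS_hom A B"
  show "compose (carrier (fst A)) h (compose (carrier (fst A)) g f)
      = compose (carrier (fst A)) (compose (carrier (fst B)) h g) f"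
    by (rule compose_compose) (rule LocS_hom_closed[OF B f])
qed (rule LocS_hom_id LocS_hom_compose; assumption)+

section \<open>Locally small spaces\<close>

lemma locally_small_spaceD:
  assumes "locally_small_space X"
  shows "{} \<in> snd X" "\<lbrakk>V \<in> snd X; W \<in> snd X\<rbrakk> \<Longrightarrow> V \<inter> W \<in> snd X"
    and "\<lbrakk>V \<in> snd X; W \<in> snd X\<rbrakk> \<Longrightarrow> V \<union> W \<in> snd X" "\<Union>(snd X) = fst X"
  using assms by (auto simp: locally_small_space_def)

lemma LSS_homD:
  assumes "f \<in> LSS_hom X Y"
  shows "f \<in> extensional (fst X)" "x \<in> fst X \<Longrightarrow> f x \<in> fst Y"
    and "W \<in> snd X \<Longrightarrow> \<exists>V\<in>snd Y. W \<subseteq> f -` V \<inter> fst X"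
    and "\<lbrakk>V \<in> snd Y; W \<in> snd X\<rbrakk> \<Longrightarrow> f -` V \<inter> fst X \<inter> W \<in> snd X"
  using assms by (auto simp: LSS_hom_def bounded_map_def continuous_lss_map_def PiE_iff)

lemma LSS_homI:
  assumes "f \<in> extensional (fst X)" "\<And>x. x \<in> fst X \<Longrightarrow> f x \<in> fst Y"
    and "\<And>W. W \<in> snd X \<Longrightarrow> \<exists>V\<in>snd Y. W \<subseteq> f -` V \<inter> fst X"
    and "\<And>V W. \<lbrakk>V \<in> snd Y; W \<in> snd X\<rbrakk> \<Longrightarrow> f -` V \<inter> fst X \<inter> W \<in> snd X"
  shows "f \<in> LSS_hom X Y"
  using assms by (simp add: LSS_hom_def bounded_map_def continuous_lss_map_def PiE_iff)

lemma LSS_hom_id: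
  assumes X: "locally_small_space X"
  shows "restrict id (fst X) \<in> LSS_hom X X"
proof (rule LSS_homI)
  note s = locally_small_spaceD[OF X]
  show "\<exists>V\<in>snd X. W \<subseteq> restrict id (fst X) -` V \<inter> fst X" if "W \<in> snd X" for W
    using that s(4) by (intro bexI[of _ W]) auto
  show "restrict id (fst X) -` V \<inter> fst X \<inter> W \<in> snd X" if "V \<in> snd X" "W \<in> snd X" for V W
  proof -
    have "restrict id (fst X) -` V \<inter> fst X \<inter> W = V \<inter> W" using that s(4) by auto
    then show ?thesis using s(2) that by simp
  qed
qed auto

text \<open>
  Boundedness of the inner map is what makes a composite continuous. The set \<open>g -` V\<close> need not
  belong to \<open>snd Y\<close>, but \<open>f\<close> maps \<open>W\<close> into some \<open>U\<close> in \<open>snd Y\<close>, and \<open>g -` V \<inter> U\<close> does.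
\<close>

lemma LSS_hom_compose:
  assumes X: "locally_small_space X" and f: "f \<in> LSS_hom X Y" and g: "g \<in> LSS_hom Y Z"
  shows "compose (fst X) g f \<in> LSS_hom X Z"
proof (rule LSS_homI)
  note fD = LSS_homD[OF f] and gD = LSS_homD[OF g]
  show "compose (fst X) g f \<in> extensional (fst X)" by (rule compose_extensional)
  show "compose (fst X) g f x \<in> fst Z" if "x \<in> fst X" for x
    using that by (simp add: compose_eq fD(2) gD(2))
  show "\<exists>V\<in>snd Z. W \<subseteq> compose (fst X) g f -` V \<inter> fst X" if W: "W \<in> snd X" for W
  proof -
    obtain U where U: "U \<in> snd Y" "W \<subseteq> f -` U \<inter> fst X" using fD(3)[OF W] by blast
    obtain V where V: "V \<in> snd Z" "U \<subseteq> g -` V \<inter> fst Y" using gD(3)[OF U(1)] by blast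
    have "W \<subseteq> compose (fst X) g f -` V \<inter> fst X"
      using U(2) V(2) by (auto simp: compose_eq subset_iff)
    with V(1) show ?thesis by blast
  qed
  show "compose (fst X) g f -` V \<inter> fst X \<inter> W \<in> snd X" if V: "V \<in> snd Z" and W: "W \<in> snd X" for V W
  proof -
    obtain U where U: "U \<in> snd Y" "W \<subseteq> f -` U \<inter> fst X" using fD(3)[OF W] by blast
    have "compose (fst X) g f -` V \<inter> fst X \<inter> W = f -` (g -` V \<inter> fst Y \<inter> U) \<inter> fst X \<inter> W"
      using U(2) fD(2) by (auto simp: compose_def)
    also have "\<dots> \<in> snd X" by (intro fD(4) gD(4) V W U(1))
    finally show ?thesis .
  qed
qed

lemma LSS_is_category: "is_category LSS"
  unfolding is_category_def LSS_def category.simps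
proof (intro conjI ballI; (unfold mem_Collect_eq)?)
  fix X Y :: "'a space" and f
  assume f: "f \<in> LSS_hom X Y"
  note c = LSS_homD(1,2)[OF f]
  show "compose (fst X) f (restrict id (fst X)) = f"
    and "compose (fst X) (restrict id (fst Y)) f = f"
    by (rule compose_restrict_id[OF c], assumption)+
next
  fix W X Y Z :: "'a space" and f g h
  assume f: "f \<in> LSS_hom W X"
  show "compose (fst W) h (compose (fst W) g f) = compose (fst W) (compose (fst X) h g) f"
    by (rule compose_compose) (rule LSS_homD(2)[OF f])
qed (rule LSS_hom_id LSS_hom_compose; assumption)+


section \<open>The frame of weakly open sets\<close>

lemma unions_iff: "W \<in> unions \<L> \<longleftrightarrow> (\<forall>x\<in>W. \<exists>V\<in>\<L>. x \<in> V \<and> V \<subseteq> W)"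
proof
  assume "\<forall>x\<in>W. \<exists>V\<in>\<L>. x \<in> V \<and> V \<subseteq> W"
  then have "W = \<Union>{V \<in> \<L>. V \<subseteq> W}" by blast
  then show "W \<in> unions \<L>" unfolding unions_def by blast
next
  assume "W \<in> unions \<L>"
  then show "\<forall>x\<in>W. \<exists>V\<in>\<L>. x \<in> V \<and> V \<subseteq> W" unfolding unions_def by blast
qed

lemma subset_unions: "\<L> \<subseteq> unions \<L>"
  by (auto simp: unions_iff)

lemma Union_in_unions:
  assumes "\<A> \<subseteq> unions \<L>"
  shows "\<Union>\<A> \<in> unions \<L>"
  unfolding unions_iff
proof
  fix x assume "x \<in> \<Union>\<A>"
  then obtain W where W: "W \<in> \<A>" "x \<in> W" by blast
  then obtain V where "V \<in> \<L>" "x \<in> V" "V \<subseteq> W" using assms by (meson subsetD unions_iff)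
  then show "\<exists>V\<in>\<L>. x \<in> V \<and> V \<subseteq> \<Union>\<A>" using W by blast
qed

lemma Int_in_unions:
  assumes X: "locally_small_space X" and "V \<in> unions (snd X)" "W \<in> unions (snd X)"
  shows "V \<inter> W \<in> unions (snd X)"
  unfolding unions_iff
proof
  fix x assume "x \<in> V \<inter> W"
  then obtain V' W' where "V' \<in> snd X" "x \<in> V'" "V' \<subseteq> V" "W' \<in> snd X" "x \<in> W'" "W' \<subseteq> W"
    using assms(2,3) by (meson IntD1 IntD2 unions_iff)
  then show "\<exists>U\<in>snd X. x \<in> U \<and> U \<subseteq> V \<inter> W"
    using locally_small_spaceD(2)[OF X] by (intro bexI[of _ "V' \<inter> W'"]) auto
qed

lemma open_frame_simps [simp]:
  "carrier (open_frame X) = unions (snd X)" "V \<sqsubseteq>\<^bsub>open_frame X\<^esub> W \<longleftrightarrow> V \<subseteq> W"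
  by (simp_all add: open_frame_def)

lemma complete_lattice_open_frame: "complete_lattice (open_frame X)"
proof -
  interpret partial_order "open_frame X"
    by unfold_locales (auto simp: open_frame_def)
  show ?thesis
  proof (rule complete_latticeI)
    fix A assume A: "A \<subseteq> carrier (open_frame X)"
    have "least (open_frame X) (\<Union>A) (Upper (open_frame X) A)"
      using A by (intro least_UpperI) (auto simp: Upper_def intro: Union_in_unions)
    then show "\<exists>s. least (open_frame X) s (Upper (open_frame X) A)" ..
    let ?I = "\<Union>{W \<in> unions (snd X). \<forall>V\<in>A. W \<subseteq> V}"
    have "greatest (open_frame X) ?I (Lower (open_frame X) A)"
      using A by (intro greatest_LowerI) (auto simp: Lower_def intro!: Union_in_unions)
    then show "\<exists>s. greatest (open_frame X) s (Lower (open_frame X) A)" ..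
  qed
qed

lemma open_frame_Sup:
  assumes "\<A> \<subseteq> unions (snd X)"
  shows "\<Squnion>\<^bsub>open_frame X\<^esub>\<A> = \<Union>\<A>"
proof -
  interpret complete_lattice "open_frame X" by (rule complete_lattice_open_frame)
  have "\<Squnion>\<^bsub>open_frame X\<^esub>\<A> \<subseteq> \<Union>\<A>"
    using sup_least[of \<A> "\<Union>\<A>"] assms by (auto simp: Union_in_unions)
  moreover have "\<Union>\<A> \<subseteq> \<Squnion>\<^bsub>open_frame X\<^esub>\<A>"
    using sup_upper[of \<A>] assms by auto
  ultimately show ?thesis by (rule equalityI)
qed

lemma open_frame_join:
  assumes "V \<in> unions (snd X)" "W \<in> unions (snd X)"
  shows "V \<squnion>\<^bsub>open_frame X\<^esub> W = V \<union> W"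
  using open_frame_Sup[of "{V, W}" X] assms by (simp add: join_def)

lemma open_frame_meet:
  assumes X: "locally_small_space X" and VW: "V \<in> unions (snd X)" "W \<in> unions (snd X)"
  shows "V \<sqinter>\<^bsub>open_frame X\<^esub> W = V \<inter> W"
proof -
  interpret complete_lattice "open_frame X" by (rule complete_lattice_open_frame)
  have "V \<inter> W \<subseteq> V \<sqinter>\<^bsub>open_frame X\<^esub> W"
    using meet_le[of "V \<inter> W" V W] Int_in_unions[OF X VW] VW by simp
  moreover have "V \<sqinter>\<^bsub>open_frame X\<^esub> W \<subseteq> V \<inter> W"
    using meet_left[of V W] meet_right[of V W] VW by simp
  ultimately show ?thesis by auto
qed

lemma open_frame_top:
  assumes X: "locally_small_space X"
  shows "\<top>\<^bsub>open_frame X\<^esub> = fst X"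
proof -
  interpret complete_lattice "open_frame X" by (rule complete_lattice_open_frame)
  have "fst X \<in> unions (snd X)"
    using locally_small_spaceD(4)[OF X] unfolding unions_iff by blast
  then have "fst X \<subseteq> \<top>\<^bsub>open_frame X\<^esub>"
    using top_higher[of "fst X"] by simp
  moreover have "\<top>\<^bsub>open_frame X\<^esub> \<in> unions (snd X)" using top_closed by simp
  then have "\<top>\<^bsub>open_frame X\<^esub> \<subseteq> fst X"
    using locally_small_spaceD(4)[OF X] unfolding unions_iff by blast
  ultimately show ?thesis by auto
qed

lemma open_frame_bottom: "\<bottom>\<^bsub>open_frame X\<^esub> = {}"
proof -
  interpret complete_lattice "open_frame X" by (rule complete_lattice_open_frame)
  have "{} \<in> unions (snd X)" by (simp add: unions_iff)
  then show ?thesis using bottom_lower[of "{}"] by simp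
qed

lemma frame_open_frame:
  assumes X: "locally_small_space X"
  shows "frame (open_frame X)"
proof -
  interpret complete_lattice "open_frame X" by (rule complete_lattice_open_frame)
  show ?thesis
  proof unfold_locales
    fix a B assume "a \<in> carrier (open_frame X)" "B \<subseteq> carrier (open_frame X)"
    then have a: "a \<in> unions (snd X)" and B: "B \<subseteq> unions (snd X)" by simp_all
    have eq: "(\<lambda>b. a \<sqinter>\<^bsub>open_frame X\<^esub> b) ` B = (\<lambda>b. a \<inter> b) ` B"
      using a B by (intro image_cong) (auto simp: open_frame_meet[OF X])
    have "(\<lambda>b. a \<inter> b) ` B \<subseteq> unions (snd X)" using a B Int_in_unions[OF X] by auto
    then show "a \<sqinter>\<^bsub>open_frame X\<^esub> \<Squnion>\<^bsub>open_frame X\<^esub>B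
        = \<Squnion>\<^bsub>open_frame X\<^esub>((\<lambda>b. a \<sqinter>\<^bsub>open_frame X\<^esub> b) ` B)"
      unfolding eq using a B
      by (simp add: open_frame_Sup open_frame_meet[OF X] Union_in_unions)
  qed
qed

lemma Omega_simps [simp]: "fst (Omega X) = open_frame X" "snd (Omega X) = snd X"
  by (simp_all add: Omega_def)

lemma special_frame_Omega:
  assumes X: "locally_small_space X"
  shows "special_frame (Omega X)"
proof -
  note s = locally_small_spaceD[OF X] and u = subsetD[OF subset_unions[of "snd X"]]
  have "\<exists>S\<subseteq>snd X. W = \<Squnion>\<^bsub>open_frame X\<^esub>S" if W: "W \<in> unions (snd X)" for W
  proof -
    obtain S where "S \<subseteq> snd X" "W = \<Union>S" using W unfolding unions_def by blast
    then show ?thesis using open_frame_Sup[of S X] u by blast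
  qed
  then show ?thesis
    unfolding special_frame_def Omega_def
    using s(1-3) frame_open_frame[OF X]
    by (auto simp: open_frame_bottom open_frame_meet[OF X] open_frame_join u)
qed

lemma vimage_in_unions:
  assumes X: "locally_small_space X" and f: "f \<in> LSS_hom X Y" and W: "W \<in> unions (snd Y)"
  shows "f -` W \<inter> fst X \<in> unions (snd X)"
  unfolding unions_iff
proof
  fix x assume x: "x \<in> f -` W \<inter> fst X"
  then obtain V where V: "V \<in> snd Y" "f x \<in> V" "V \<subseteq> W" using W unfolding unions_iff by blast
  obtain U where U: "U \<in> snd X" "x \<in> U" using x locally_small_spaceD(4)[OF X] by blast
  show "\<exists>U\<in>snd X. x \<in> U \<and> U \<subseteq> f -` W \<inter> fst X"
    using x V(2,3) U(2) by (intro bexI[OF _ LSS_homD(4)[OF f V(1) U(1)]]) auto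
qed

text \<open>
  Boundedness of \<open>f\<close> is exactly the condition that the preimage map is dominating, and
  continuity of \<open>f\<close> is exactly its compatibility.
\<close>

lemma preimage_hom_in_FrmS_hom:
  assumes X: "locally_small_space X" and Y: "locally_small_space Y" and f: "f \<in> LSS_hom X Y"
  shows "preimage_hom X Y f \<in> FrmS_hom (Omega Y) (Omega X)"
proof -
  note fD = LSS_homD[OF f] and vim = vimage_in_unions[OF X f]
  note uX = subsetD[OF subset_unions[of "snd X"]] and uY = subsetD[OF subset_unions[of "snd Y"]]
  have pre: "preimage_hom X Y f W = f -` W \<inter> fst X" if "W \<in> unions (snd Y)" for W
    using that by (simp add: preimage_hom_def)
  have Un: "V \<union> W \<in> unions (snd Y)" if "V \<in> unions (snd Y)" "W \<in> unions (snd Y)" for V W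
    using Union_in_unions[of "{V, W}"] that by simp
  have "preimage_hom X Y f (\<Squnion>\<^bsub>open_frame Y\<^esub>\<A>) = \<Squnion>\<^bsub>open_frame X\<^esub>(preimage_hom X Y f ` \<A>)"
    if A: "\<A> \<subseteq> unions (snd Y)" for \<A>
  proof -
    have eq: "preimage_hom X Y f ` \<A> = (\<lambda>W. f -` W \<inter> fst X) ` \<A>"
      using A by (intro image_cong) (auto simp: pre)
    have "(\<lambda>W. f -` W \<inter> fst X) ` \<A> \<subseteq> unions (snd X)" using A vim by auto
    then show ?thesis
      unfolding eq using A by (auto simp: open_frame_Sup pre Union_in_unions)
  qed
  moreover have "preimage_hom X Y f \<in> unions (snd Y) \<rightarrow>\<^sub>E unions (snd X)"
    using vim by (auto simp: preimage_hom_def)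
  ultimately have "frame_hom (open_frame Y) (open_frame X) (preimage_hom X Y f)"
    unfolding frame_hom_def
    by (auto simp: pre open_frame_meet[OF X] open_frame_meet[OF Y] open_frame_join vim Un
        Int_in_unions[OF Y])
  moreover have "\<exists>V\<in>snd Y. W \<subseteq> preimage_hom X Y f V" if "W \<in> snd X" for W
    using fD(3)[OF that] pre[OF uY] by metis
  moreover have "preimage_hom X Y f V \<sqinter>\<^bsub>open_frame X\<^esub> W \<in> snd X"
    if V: "V \<in> snd Y" and W: "W \<in> snd X" for V W
    unfolding pre[OF uY[OF V]] open_frame_meet[OF X vim[OF uY[OF V]] uX[OF W]]
    by (rule fD(4)[OF V W])
  ultimately show ?thesis
    by (intro FrmS_homI[OF special_frame_Omega[OF Y] special_frame_Omega[OF X]])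
      (simp_all only: Omega_simps open_frame_simps)
qed

lemma frame_hom_preimage_hom:
  assumes X: "locally_small_space X" and Y: "locally_small_space Y" and f: "f \<in> LSS_hom X Y"
  shows "frame_hom (open_frame Y) (open_frame X) (preimage_hom X Y f)"
  using FrmS_homD(1)[OF special_frame_Omega[OF Y] special_frame_Omega[OF X]
      preimage_hom_in_FrmS_hom[OF X Y f]]
  unfolding Omega_simps .

text \<open>
  The Galois connection for the preimage homomorphism; it characterises \<open>Omega_map X Y f W\<close> without
  reference to the join that defines it.
\<close>

lemma subset_Omega_map_iff:
  assumes X: "locally_small_space X" and Y: "locally_small_space Y" and f: "f \<in> LSS_hom X Y"
    and V: "V \<in> unions (snd Y)" and W: "W \<in> unions (snd X)"
  shows "V \<subseteq> Omega_map X Y f W \<longleftrightarrow> f -` V \<inter> fst X \<subseteq> W"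
  using le_right_adj_iff[OF frame_open_frame[OF Y] frame_open_frame[OF X]
      frame_hom_preimage_hom[OF X Y f], of V W] V W
  unfolding Omega_map_def open_frame_simps by (simp add: preimage_hom_def)

lemma Omega_map_in_LocS_hom:
  assumes "locally_small_space X" "locally_small_space Y" "f \<in> LSS_hom X Y"
  shows "Omega_map X Y f \<in> LocS_hom (Omega X) (Omega Y)"
  using imageI[OF preimage_hom_in_FrmS_hom[OF assms]]
  unfolding LocS_hom_def Omega_map_def Omega_simps .

lemma Omega_map_closed:
  assumes "locally_small_space X" "locally_small_space Y" "f \<in> LSS_hom X Y" "W \<in> unions (snd X)"
  shows "Omega_map X Y f W \<in> unions (snd Y)"
  using right_adj_closed[OF frame_open_frame[OF assms(2)], of W "open_frame X"] assms(4)
  unfolding Omega_map_def open_frame_simps by blast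

lemma preimage_hom_id:
  assumes X: "locally_small_space X"
  shows "preimage_hom X X (restrict id (fst X)) = restrict id (unions (snd X))"
proof
  fix W
  have "W \<subseteq> fst X" if "W \<in> unions (snd X)"
    using that locally_small_spaceD(4)[OF X] unfolding unions_iff by blast
  then show "preimage_hom X X (restrict id (fst X)) W = restrict id (unions (snd X)) W"
    by (auto simp: preimage_hom_def)
qed

lemma preimage_hom_compose:
  assumes Y: "locally_small_space Y" and f: "f \<in> LSS_hom X Y" and g: "g \<in> LSS_hom Y Z"
  shows "preimage_hom X Z (compose (fst X) g f)
    = compose (unions (snd Z)) (preimage_hom X Y f) (preimage_hom Y Z g)"
proof
  fix W
  show "preimage_hom X Z (compose (fst X) g f) W
    = compose (unions (snd Z)) (preimage_hom X Y f) (preimage_hom Y Z g) W"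
  proof (cases "W \<in> unions (snd Z)")
    case True
    with vimage_in_unions[OF Y g True] LSS_homD(2)[OF f] show ?thesis
      by (auto simp: preimage_hom_def compose_def)
  qed (simp add: preimage_hom_def compose_def)
qed

lemma Omega_is_functor: "is_functor LSS LocS Omega Omega_map"
  unfolding is_functor_def
proof (intro conjI ballI LSS_is_category LocS_is_category)
  fix X :: "'a space" assume "X \<in> Obj LSS"
  then have X: "locally_small_space X" by (simp add: LSS_def)
  show "Omega X \<in> Obj LocS" using special_frame_Omega[OF X] by (simp add: LocS_def)
  show "Omega_map X X (Id LSS X) = Id LocS (Omega X)"
    using right_adj_id[OF frame_open_frame[OF X]]
    by (simp add: LSS_def LocS_def Omega_map_def preimage_hom_id[OF X])
next
  fix X Y :: "'a space" and f assume "X \<in> Obj LSS" "Y \<in> Obj LSS" "f \<in> Hom LSS X Y"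
  then show "Omega_map X Y f \<in> Hom LocS (Omega X) (Omega Y)"
    by (simp add: LSS_def LocS_def Omega_map_in_LocS_hom)
next
  fix X Y Z :: "'a space" and f g
  assume "X \<in> Obj LSS" "Y \<in> Obj LSS" "Z \<in> Obj LSS" "f \<in> Hom LSS X Y" "g \<in> Hom LSS Y Z"
  then have s: "locally_small_space X" "locally_small_space Y" "locally_small_space Z"
    and fg: "f \<in> LSS_hom X Y" "g \<in> LSS_hom Y Z" by (simp_all add: LSS_def)
  note c = right_adj_compose[OF frame_open_frame[OF s(3)] frame_open_frame[OF s(2)]
      frame_open_frame[OF s(1)] frame_hom_preimage_hom[OF s(2,3) fg(2)]
      frame_hom_preimage_hom[OF s(1,2) fg(1)]]
  show "Omega_map X Z (Cmp LSS X Y Z g f)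
    = Cmp LocS (Omega X) (Omega Y) (Omega Z) (Omega_map Y Z g) (Omega_map X Y f)"
    using c by (simp add: LSS_def LocS_def Omega_map_def preimage_hom_compose[OF s(2) fg])
qed


section \<open>The spectrum of a special frame\<close>

lemma Sigma_obj_simps [simp]:
  "fst (Sigma_obj A) = Spec (fst A)" "snd (Sigma_obj A) = Delta (fst A) ` snd A"
  by (simp_all add: Sigma_obj_def)

lemma locally_small_space_Sigma_obj:
  assumes A: "special_frame A"
  shows "locally_small_space (Sigma_obj A)"
proof -
  interpret L: frame "fst A" by (rule special_frameD(1)[OF A])
  note s = special_frameD[OF A]
  have "{} = Delta (fst A) \<bottom>\<^bsub>fst A\<^esub>" by (simp add: Delta_bottom[OF s(1)])
  then have "{} \<in> Delta (fst A) ` snd A" using s(3) by blast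
  moreover have "Delta (fst A) a \<inter> Delta (fst A) b \<in> Delta (fst A) ` snd A"
    "Delta (fst A) a \<union> Delta (fst A) b \<in> Delta (fst A) ` snd A" if "a \<in> snd A" "b \<in> snd A" for a b
    using imageI[OF s(4)[OF that], of "Delta (fst A)"] imageI[OF s(5)[OF that], of "Delta (fst A)"]
      Delta_meet[OF s(1), of a b] Delta_join[OF s(1), of a b] subsetD[OF s(2)] that
    by simp_all
  moreover have "\<Union>(Delta (fst A) ` snd A) = Spec (fst A)"
  proof
    show "Spec (fst A) \<subseteq> \<Union>(Delta (fst A) ` snd A)"
    proof
      fix p assume p: "p \<in> Spec (fst A)"
      note pD = SpecD[OF s(1) p]
      obtain l where "l \<in> snd A" "\<not> l \<sqsubseteq>\<^bsub>fst A\<^esub> p"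
        using pD special_frame_le_iff[OF A L.top_closed pD(1)] by blast
      then show "p \<in> \<Union>(Delta (fst A) ` snd A)" using p by (auto simp: Delta_def)
    qed
  qed (auto simp: Delta_def)
  ultimately show ?thesis
    unfolding locally_small_space_def Sigma_obj_simps by blast
qed

text \<open>
  A special localic map preserves primes: if \<open>a \<sqinter> b \<sqsubseteq> h\<^sub>* p\<close> then \<open>h a \<sqinter> h b \<sqsubseteq> p\<close>, and primality of
  \<open>p\<close> transfers back through the adjunction. That \<open>h\<^sub>* p\<close> is proper needs \<open>h \<top> = \<top>\<close>.
\<close>

lemma right_adj_in_Spec:
  assumes A: "special_frame A" and B: "special_frame B" and h: "h \<in> FrmS_hom A B"
    and p: "p \<in> Spec (fst B)"
  shows "right_adj (fst A) (fst B) h p \<in> Spec (fst A)"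
proof -
  note sA = special_frameD(1)[OF A] and sB = special_frameD(1)[OF B]
  interpret L: frame "fst A" by (rule sA)
  note fh = FrmS_homD(1)[OF A B h]
  note pD = p[unfolded Spec_iff_prime[OF sB]]
  note adj = le_right_adj_iff[OF sA sB fh _ SpecD(1)[OF sB p]]
  show ?thesis
    unfolding Spec_iff_prime[OF sA]
    using pD by (auto simp: adj right_adj_closed[OF sA] FrmS_hom_top[OF A B h] frame_homD(2,3)[OF fh])
qed

lemma Sigma_map_in_LSS_hom:
  assumes A: "special_frame A" and B: "special_frame B" and k: "k \<in> LocS_hom B A"
  shows "Sigma_map B A k \<in> LSS_hom (Sigma_obj B) (Sigma_obj A)"
proof -
  note sA = special_frameD[OF A] and sB = special_frameD[OF B]
  interpret L: frame "fst A" by (rule sA)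
  interpret M: frame "fst B" by (rule sB)
  obtain h where h: "h \<in> FrmS_hom A B" and k: "k = right_adj (fst A) (fst B) h"
    using k by (rule LocS_homE)
  note hD = FrmS_homD[OF A B h]
  note hF = frame_homD[OF hD(1)] and As = subsetD[OF sA(2)] and Bs = subsetD[OF sB(2)]
  have spec: "k p \<in> Spec (fst A)" if "p \<in> Spec (fst B)" for p
    unfolding k by (rule right_adj_in_Spec[OF A B h that])
  have vim: "Sigma_map B A k -` Delta (fst A) l \<inter> Spec (fst B) = Delta (fst B) (h l)"
    if l: "l \<in> snd A" for l
  proof -
    have "l \<sqsubseteq>\<^bsub>fst A\<^esub> k p \<longleftrightarrow> h l \<sqsubseteq>\<^bsub>fst B\<^esub> p" if "p \<in> Spec (fst B)" for p
      unfolding k using As[OF l] SpecD(1)[OF sB(1) that]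
      by (rule le_right_adj_iff[OF sA(1) sB(1) hD(1)])
    then show ?thesis using spec by (auto simp: Delta_def Sigma_map_def)
  qed
  show ?thesis
  proof (rule LSS_homI; (unfold Sigma_obj_simps)?)
    show "Sigma_map B A k \<in> extensional (Spec (fst B))" by (simp add: Sigma_map_def)
    show "Sigma_map B A k p \<in> Spec (fst A)" if "p \<in> Spec (fst B)" for p
      using that spec by (simp add: Sigma_map_def)
  next
    fix W assume "W \<in> Delta (fst B) ` snd B"
    then obtain m where m: "m \<in> snd B" "W = Delta (fst B) m" by blast
    obtain l where l: "l \<in> snd A" "m \<sqsubseteq>\<^bsub>fst B\<^esub> h l" using hD(2)[OF m(1)] by blast
    have "W \<subseteq> Delta (fst B) (h l)"
      unfolding m(2) Delta_def using l m(1) Bs As hF(2) SpecD(1)[OF sB(1)]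
      by (blast intro: M.le_trans)
    then show "\<exists>V\<in>Delta (fst A) ` snd A. W \<subseteq> Sigma_map B A k -` V \<inter> Spec (fst B)"
      using vim[OF l(1)] l(1) by blast
  next
    fix V W assume "V \<in> Delta (fst A) ` snd A" "W \<in> Delta (fst B) ` snd B"
    then obtain l m where l: "l \<in> snd A" "V = Delta (fst A) l"
      and m: "m \<in> snd B" "W = Delta (fst B) m" by blast
    have "Sigma_map B A k -` V \<inter> Spec (fst B) \<inter> W = Delta (fst B) (h l \<sqinter>\<^bsub>fst B\<^esub> m)"
      unfolding l(2) m(2) vim[OF l(1)]
      by (rule Delta_meet[OF sB(1), symmetric]) (simp_all add: hF(2) As l(1) Bs m(1))
    then show "Sigma_map B A k -` V \<inter> Spec (fst B) \<inter> W \<in> Delta (fst B) ` snd B"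
      using hD(3)[OF m(1) l(1)] by simp
  qed
qed

lemma Sigma_is_functor: "is_functor LocS LSS Sigma_obj Sigma_map"
  unfolding is_functor_def
proof (intro conjI ballI LSS_is_category LocS_is_category)
  fix A :: "'a sframe" assume "A \<in> Obj LocS"
  then have A: "special_frame A" by (simp add: LocS_def)
  show "Sigma_obj A \<in> Obj LSS"
    using locally_small_space_Sigma_obj[OF A] by (simp add: LSS_def)
  show "Sigma_map A A (Id LocS A) = Id LSS (Sigma_obj A)"
    using SpecD(1)[OF special_frameD(1)[OF A]]
    by (auto simp: LocS_def LSS_def Sigma_map_def fun_eq_iff)
next
  fix A B :: "'a sframe" and k assume "A \<in> Obj LocS" "B \<in> Obj LocS" "k \<in> Hom LocS A B"
  then show "Sigma_map A B k \<in> Hom LSS (Sigma_obj A) (Sigma_obj B)"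
    by (simp add: LocS_def LSS_def Sigma_map_in_LSS_hom)
next
  fix A B C :: "'a sframe" and k j
  assume "A \<in> Obj LocS" "B \<in> Obj LocS" "C \<in> Obj LocS" "k \<in> Hom LocS A B" "j \<in> Hom LocS B C"
  then have s: "special_frame A" "special_frame B" and k: "k \<in> LocS_hom A B"
    by (simp_all add: LocS_def)
  have "k p \<in> Spec (fst B)" "p \<in> carrier (fst A)" if "p \<in> Spec (fst A)" for p
    using LSS_homD(2)[OF Sigma_map_in_LSS_hom[OF s(2,1) k]] SpecD(1)[OF special_frameD(1)[OF s(1)] that] that
    by (simp_all add: Sigma_map_def)
  then show "Sigma_map A C (Cmp LocS A B C j k)
    = Cmp LSS (Sigma_obj A) (Sigma_obj B) (Sigma_obj C) (Sigma_map B C j) (Sigma_map A B k)"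
    by (auto simp: LocS_def LSS_def Sigma_map_def compose_def fun_eq_iff)
qed


section \<open>Points of a space as primes\<close>

text \<open>
  The largest weakly open set missing \<open>x\<close>, that is, the complement of the closure of \<open>x\<close>. The
  map \<open>x \<mapsto> point_prime X x\<close> is the unit of the adjunction.
\<close>

definition point_prime :: "'a space \<Rightarrow> 'a \<Rightarrow> 'a set" where
  "point_prime X x = \<Union>{W \<in> unions (snd X). x \<notin> W}"

lemma point_prime_in_unions: "point_prime X x \<in> unions (snd X)"
  unfolding point_prime_def by (rule Union_in_unions) auto

lemma subset_point_prime_iff:
  assumes "W \<in> unions (snd X)"
  shows "W \<subseteq> point_prime X x \<longleftrightarrow> x \<notin> W"
  using assms unfolding point_prime_def by auto

lemma point_prime_in_Spec:
  assumes X: "locally_small_space X" and x: "x \<in> fst X"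
  shows "point_prime X x \<in> Spec (open_frame X)"
proof -
  note sub = subset_point_prime_iff[where X = X and x = x]
  interpret frame "open_frame X" by (rule frame_open_frame[OF X])
  have "fst X \<in> unions (snd X)" using top_closed open_frame_top[OF X] by simp
  then show ?thesis
    unfolding Spec_iff_prime[OF frame_open_frame[OF X]]
    using x by (auto simp: open_frame_top[OF X] open_frame_meet[OF X] sub Int_in_unions[OF X]
        point_prime_in_unions)
qed

text \<open>
  Naturality of the unit: both sides are the largest weakly open set whose preimage under \<open>f\<close>
  misses \<open>x\<close>.
\<close>

lemma Omega_map_point_prime:
  assumes X: "locally_small_space X" and Y: "locally_small_space Y" and f: "f \<in> LSS_hom X Y"
    and x: "x \<in> fst X"
  shows "Omega_map X Y f (point_prime X x) = point_prime Y (f x)"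
proof -
  interpret frame "open_frame Y" by (rule frame_open_frame[OF Y])
  show ?thesis
    by (rule eqI_below)
      (use x in \<open>auto simp: Omega_map_closed[OF X Y f] point_prime_in_unions
        subset_point_prime_iff subset_Omega_map_iff[OF X Y f] vimage_in_unions[OF X f]\<close>)
qed


section \<open>The adjunction\<close>

definition spatial_transpose :: "'a space \<Rightarrow> ('a set \<Rightarrow> 'b) \<Rightarrow> 'a \<Rightarrow> 'b" where
  "spatial_transpose X k = (\<lambda>x\<in>fst X. k (point_prime X x))"

text \<open>
  Both adjunctions at once: \<open>l\<close> lies below \<open>h\<^sub>*\<close> of a weakly open set \<open>W\<close> exactly when \<open>h l\<close> lies in
  \<open>W\<close>, and for the largest \<open>W\<close> missing \<open>x\<close> this says that \<open>h l\<close> misses \<open>x\<close>.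
\<close>

lemma le_transpose_iff:
  assumes X: "locally_small_space X" and A: "special_frame A" and h: "h \<in> FrmS_hom A (Omega X)"
    and x: "x \<in> fst X" and l: "l \<in> carrier (fst A)"
  shows "l \<sqsubseteq>\<^bsub>fst A\<^esub> spatial_transpose X (right_adj (fst A) (open_frame X) h) x \<longleftrightarrow> x \<notin> h l"
proof -
  note fh = FrmS_homD(1)[OF A special_frame_Omega[OF X] h, unfolded Omega_simps]
  show ?thesis
    using x l frame_homD(2)[OF fh l]
    by (simp add: spatial_transpose_def point_prime_in_unions subset_point_prime_iff
        le_right_adj_iff[OF special_frameD(1)[OF A] frame_open_frame[OF X] fh])
qed

lemma transpose_in_Spec:
  assumes X: "locally_small_space X" and A: "special_frame A" and k: "k \<in> LocS_hom (Omega X) A"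
    and x: "x \<in> fst X"
  shows "spatial_transpose X k x \<in> Spec (fst A)"
proof -
  obtain h where h: "h \<in> FrmS_hom A (Omega X)" "k = right_adj (fst A) (fst (Omega X)) h"
    using k by (rule LocS_homE)
  show ?thesis
    using right_adj_in_Spec[OF A special_frame_Omega[OF X] h(1)] x point_prime_in_Spec[OF X x]
    by (simp add: spatial_transpose_def h(2))
qed

text \<open>
  The transpose of \<open>h\<^sub>*\<close> recovers \<open>h\<close>. Hence transposition is injective, and the boundedness and
  continuity of the transpose are the domination and compatibility of \<open>h\<close>.
\<close>

lemma vimage_transpose:
  assumes X: "locally_small_space X" and A: "special_frame A" and h: "h \<in> FrmS_hom A (Omega X)"
    and l: "l \<in> carrier (fst A)"
  shows "spatial_transpose X (right_adj (fst A) (open_frame X) h) -` Delta (fst A) l \<inter> fst X = h l"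
proof -
  have k: "right_adj (fst A) (open_frame X) h \<in> LocS_hom (Omega X) A"
    using h by (simp add: LocS_hom_def)
  have "h l \<in> unions (snd X)"
    using frame_homD(2)[OF FrmS_homD(1)[OF A special_frame_Omega[OF X] h] l] by simp
  then have "h l \<subseteq> fst X"
    using locally_small_spaceD(4)[OF X] unfolding unions_iff by blast
  then show ?thesis
    using le_transpose_iff[OF X A h _ l] transpose_in_Spec[OF X A k] by (auto simp: Delta_def)
qed

lemma transpose_in_LSS_hom:
  assumes X: "locally_small_space X" and A: "special_frame A" and k: "k \<in> LocS_hom (Omega X) A"
  shows "spatial_transpose X k \<in> LSS_hom X (Sigma_obj A)"
proof -
  note O = special_frame_Omega[OF X] and As = subsetD[OF special_frameD(2)[OF A]]
  obtain h where h: "h \<in> FrmS_hom A (Omega X)" "k = right_adj (fst A) (open_frame X) h"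
    using k by (metis LocS_homE Omega_simps(1))
  note hD = FrmS_homD[OF A O h(1), unfolded Omega_simps]
  have vim: "spatial_transpose X k -` Delta (fst A) l \<inter> fst X = h l" if "l \<in> snd A" for l
    unfolding h(2) by (rule vimage_transpose[OF X A h(1) As[OF that]])
  show ?thesis
  proof (rule LSS_homI; (unfold Sigma_obj_simps)?)
    show "spatial_transpose X k \<in> extensional (fst X)" by (simp add: spatial_transpose_def)
    show "spatial_transpose X k x \<in> Spec (fst A)" if "x \<in> fst X" for x
      by (rule transpose_in_Spec[OF X A k that])
    show "\<exists>V\<in>Delta (fst A) ` snd A. W \<subseteq> spatial_transpose X k -` V \<inter> fst X" if W: "W \<in> snd X" for W
    proof -
      obtain l where l: "l \<in> snd A" "W \<subseteq> h l" using hD(2)[OF W] by auto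
      from l(2) show ?thesis unfolding vim[OF l(1), symmetric] using l(1) by blast
    qed
    fix V W assume "V \<in> Delta (fst A) ` snd A" and W: "W \<in> snd X"
    then obtain l where l: "l \<in> snd A" "V = Delta (fst A) l" by blast
    have "h l \<sqinter>\<^bsub>open_frame X\<^esub> W = h l \<inter> W"
      using frame_homD(2)[OF hD(1) As[OF l(1)]] subsetD[OF subset_unions W]
      by (simp add: open_frame_meet[OF X])
    then show "spatial_transpose X k -` V \<inter> fst X \<inter> W \<in> snd X"
      using hD(3)[OF W l(1)] by (simp add: l(2) vim[OF l(1)])
  qed
qed

lemma inj_on_transpose:
  assumes X: "locally_small_space X" and A: "special_frame A"
  shows "inj_on (spatial_transpose X) (LocS_hom (Omega X) A)"
proof (rule inj_onI)
  fix k k' assume k: "k \<in> LocS_hom (Omega X) A" and k': "k' \<in> LocS_hom (Omega X) A"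
    and eq: "spatial_transpose X k = spatial_transpose X k'"
  obtain h where h: "h \<in> FrmS_hom A (Omega X)" "k = right_adj (fst A) (open_frame X) h"
    using k by (metis LocS_homE Omega_simps(1))
  obtain h' where h': "h' \<in> FrmS_hom A (Omega X)" "k' = right_adj (fst A) (open_frame X) h'"
    using k' by (metis LocS_homE Omega_simps(1))
  have ext: "h \<in> extensional (carrier (fst A))" "h' \<in> extensional (carrier (fst A))"
    using h(1) h'(1) by (auto simp: FrmS_hom_def dest: frame_homD(1))
  have "h = h'"
    using vimage_transpose[OF X A h(1)] vimage_transpose[OF X A h'(1)] eq h(2) h'(2)
    by (intro extensionalityI[OF ext]) metis
  then show "k = k'" using h(2) h'(2) by simp
qed

definition spectral_preimage :: "'a space \<Rightarrow> 'b sframe \<Rightarrow> ('a \<Rightarrow> 'b) \<Rightarrow> 'b \<Rightarrow> 'a set" where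
  "spectral_preimage X A f = (\<lambda>l\<in>carrier (fst A). f -` Delta (fst A) l \<inter> fst X)"

text \<open>
  The map \<open>\<Delta>\<close> preserves joins and binary meets, and so does taking preimages. An arbitrary \<open>l\<close> is a
  join of elements of \<open>A\<^sub>s\<close>, which makes \<open>\<Delta> l\<close> weakly open and its preimage an element of the frame.
  Domination and compatibility restate that \<open>f\<close> is bounded and continuous.
\<close>

lemma spectral_preimage_in_FrmS_hom:
  assumes X: "locally_small_space X" and A: "special_frame A" and f: "f \<in> LSS_hom X (Sigma_obj A)"
  shows "spectral_preimage X A f \<in> FrmS_hom A (Omega X)"
proof -
  note s = special_frameD[OF A] and fD = LSS_homD[OF f, unfolded Sigma_obj_simps]
  interpret L: frame "fst A" by (rule s)
  let ?h = "spectral_preimage X A f"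
  have h: "?h l = f -` Delta (fst A) l \<inter> fst X" if "l \<in> carrier (fst A)" for l
    using that by (simp add: spectral_preimage_def)
  have closed: "f -` Delta (fst A) l \<inter> fst X \<in> unions (snd X)" if l: "l \<in> carrier (fst A)" for l
  proof (rule vimage_in_unions[OF X f])
    obtain S where S: "S \<subseteq> snd A" "l = \<Squnion>\<^bsub>fst A\<^esub>S" using s(6)[OF l] by blast
    then have "Delta (fst A) l = \<Union>(Delta (fst A) ` S)"
      using Delta_Sup[OF s(1), of S] s(2) by auto
    then show "Delta (fst A) l \<in> unions (snd (Sigma_obj A))"
      using Union_in_unions[OF order_trans[OF image_mono[OF S(1)] subset_unions]] by simp
  qed
  have "?h (\<Squnion>\<^bsub>fst A\<^esub>S) = \<Squnion>\<^bsub>open_frame X\<^esub>(?h ` S)" if S: "S \<subseteq> carrier (fst A)" for S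
  proof -
    have eq: "?h ` S = (\<lambda>l. f -` Delta (fst A) l \<inter> fst X) ` S"
      using S by (intro image_cong) (auto simp: h)
    have "(\<lambda>l. f -` Delta (fst A) l \<inter> fst X) ` S \<subseteq> unions (snd X)" using S closed by auto
    then show ?thesis
      unfolding eq using S by (auto simp: open_frame_Sup h Delta_Sup[OF s(1)])
  qed
  moreover have "?h \<in> carrier (fst A) \<rightarrow>\<^sub>E unions (snd X)"
    using closed by (auto simp: spectral_preimage_def)
  ultimately have "frame_hom (fst A) (open_frame X) ?h"
    unfolding frame_hom_def
    by (auto simp: h closed open_frame_meet[OF X] open_frame_join Delta_meet[OF s(1)]
        Delta_join[OF s(1)])
  moreover have "\<exists>l\<in>snd A. W \<subseteq> ?h l" if "W \<in> snd X" for W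
  proof -
    from fD(3)[OF that] obtain l where l: "l \<in> snd A" "W \<subseteq> f -` Delta (fst A) l \<inter> fst X"
      by auto
    from l(2) show ?thesis unfolding h[OF subsetD[OF s(2) l(1)], symmetric] using l(1) by blast
  qed
  moreover have "?h l \<sqinter>\<^bsub>open_frame X\<^esub> W \<in> snd X" if W: "W \<in> snd X" and l: "l \<in> snd A" for W l
  proof -
    have "?h l \<sqinter>\<^bsub>open_frame X\<^esub> W = f -` Delta (fst A) l \<inter> fst X \<inter> W"
      using closed[of l] h[of l] l s(2) subsetD[OF subset_unions W]
      by (auto simp: open_frame_meet[OF X])
    then show ?thesis using fD(4)[of "Delta (fst A) l" W] l W by simp
  qed
  ultimately show ?thesis
    by (intro FrmS_homI[OF A special_frame_Omega[OF X]]) simp_all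
qed

text \<open>
  Surjectivity of transposition. Two elements of a frame agree if they have the same elements
  below them, and \<open>l\<close> lies below either side at \<open>x\<close> exactly when \<open>f x\<close> is not in \<open>\<Delta> l\<close>.
\<close>

lemma transpose_spectral_preimage:
  assumes X: "locally_small_space X" and A: "special_frame A" and f: "f \<in> LSS_hom X (Sigma_obj A)"
  shows "spatial_transpose X (right_adj (fst A) (open_frame X) (spectral_preimage X A f)) = f"
    (is "spatial_transpose X ?k = f")
proof (rule extensionalityI[of _ "fst X"])
  note s = special_frameD[OF A] and fD = LSS_homD[OF f, unfolded Sigma_obj_simps]
  interpret L: frame "fst A" by (rule s)
  note h = spectral_preimage_in_FrmS_hom[OF X A f]
  show "spatial_transpose X ?k \<in> extensional (fst X)" by (simp add: spatial_transpose_def)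
  show "f \<in> extensional (fst X)" by (rule fD(1))
  fix x assume x: "x \<in> fst X"
  have k: "?k \<in> LocS_hom (Omega X) A" using h by (simp add: LocS_hom_def)
  show "spatial_transpose X ?k x = f x"
  proof (rule L.eqI_below)
    show "spatial_transpose X ?k x \<in> carrier (fst A)"
      by (rule SpecD(1)[OF s(1) transpose_in_Spec[OF X A k x]])
    show "f x \<in> carrier (fst A)" by (rule SpecD(1)[OF s(1) fD(2)[OF x]])
    fix l assume l: "l \<in> carrier (fst A)"
    show "l \<sqsubseteq>\<^bsub>fst A\<^esub> spatial_transpose X ?k x \<longleftrightarrow> l \<sqsubseteq>\<^bsub>fst A\<^esub> f x"
      unfolding le_transpose_iff[OF X A h x l]
      using fD(2)[OF x] x l by (simp add: spectral_preimage_def Delta_def)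
  qed
qed

lemma bij_betw_transpose:
  assumes X: "locally_small_space X" and A: "special_frame A"
  shows "bij_betw (spatial_transpose X) (LocS_hom (Omega X) A) (LSS_hom X (Sigma_obj A))"
proof -
  have "f \<in> spatial_transpose X ` LocS_hom (Omega X) A" if f: "f \<in> LSS_hom X (Sigma_obj A)" for f
    using transpose_spectral_preimage[OF X A f] spectral_preimage_in_FrmS_hom[OF X A f]
    unfolding LocS_hom_def by (metis Omega_simps(1) imageI)
  then show ?thesis
    using transpose_in_LSS_hom[OF X A] inj_on_transpose[OF X A] by (auto simp: bij_betw_def)
qed

text \<open>
  Naturality reduces to \<open>Omega_map X' X f (point_prime X' x) = point_prime X (f x)\<close>, since the
  functor on spectra merely restricts \<open>g\<close>.
\<close>

lemma transpose_natural:
  assumes X: "locally_small_space X" and X': "locally_small_space X'"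
    and A: "special_frame A" and f: "f \<in> LSS_hom X' X" and k: "k \<in> LocS_hom (Omega X) A"
  shows "spatial_transpose X' (compose (unions (snd X')) g (compose (unions (snd X')) k (Omega_map X' X f)))
    = compose (fst X') (Sigma_map A A' g) (compose (fst X') (spatial_transpose X k) f)"
proof (rule extensionalityI[of _ "fst X'"])
  fix x assume x: "x \<in> fst X'"
  have fx: "f x \<in> fst X" by (rule LSS_homD(2)[OF f x])
  have "k (point_prime X (f x)) \<in> Spec (fst A)"
    using transpose_in_Spec[OF X A k fx] fx by (simp add: spatial_transpose_def)
  then show "spatial_transpose X' (compose (unions (snd X')) g (compose (unions (snd X')) k (Omega_map X' X f))) x
      = compose (fst X') (Sigma_map A A' g) (compose (fst X') (spatial_transpose X k) f) x"
    using x fx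
    by (simp add: spatial_transpose_def compose_eq point_prime_in_unions Omega_map_point_prime[OF X' X f x]
        Sigma_map_def)
qed (simp_all add: spatial_transpose_def)


theorem theorem29:
  shows "is_functor (LSS :: ('a space, 'a \<Rightarrow> 'a) category)
           (LocS :: ('a set sframe, 'a set \<Rightarrow> 'a set) category) Omega Omega_map
    \<and> is_functor (LocS :: ('b sframe, 'b \<Rightarrow> 'b) category)
           (LSS :: ('b space, 'b \<Rightarrow> 'b) category) Sigma_obj Sigma_map
    \<and> (\<exists>\<phi> :: 'a space \<Rightarrow> 'b sframe \<Rightarrow> ('a set \<Rightarrow> 'b) \<Rightarrow> ('a \<Rightarrow> 'b).
         (\<forall>X\<in>Obj LSS. \<forall>L\<in>Obj LocS.
            bij_betw (\<phi> X L) (LocS_hom (Omega X) L) (LSS_hom X (Sigma_obj L)))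
       \<and> (\<forall>X\<in>Obj LSS. \<forall>X'\<in>Obj LSS. \<forall>L\<in>Obj LocS. \<forall>L'\<in>Obj LocS.
            \<forall>f\<in>LSS_hom X' X. \<forall>g\<in>LocS_hom L L'. \<forall>k\<in>LocS_hom (Omega X) L.
              \<phi> X' L' (compose (carrier (fst (Omega X'))) g
                         (compose (carrier (fst (Omega X'))) k (Omega_map X' X f)))
              = compose (fst X') (Sigma_map L L' g) (compose (fst X') (\<phi> X L k) f)))"
proof (intro conjI exI[of _ "\<lambda>X _. spatial_transpose X"] ballI)
  show "is_functor (LSS :: ('a space, 'a \<Rightarrow> 'a) category) LocS Omega Omega_map"
    by (rule Omega_is_functor)
  show "is_functor (LocS :: ('b sframe, 'b \<Rightarrow> 'b) category) LSS Sigma_obj Sigma_map"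
    by (rule Sigma_is_functor)
next
  fix X :: "'a space" and L :: "'b sframe"
  assume "X \<in> Obj LSS" "L \<in> Obj LocS"
  then show "bij_betw (spatial_transpose X) (LocS_hom (Omega X) L) (LSS_hom X (Sigma_obj L))"
    by (intro bij_betw_transpose) (simp_all add: LSS_def LocS_def)
next
  fix X X' :: "'a space" and L L' :: "'b sframe" and f g k
  assume "X \<in> Obj LSS" "X' \<in> Obj LSS" "L \<in> Obj LocS"
    and f: "f \<in> LSS_hom X' X" and k: "k \<in> LocS_hom (Omega X) L"
  then have "locally_small_space X" "locally_small_space X'" "special_frame L"
    by (simp_all add: LSS_def LocS_def)
  from transpose_natural[OF this f k]
  show "spatial_transpose X' (compose (carrier (fst (Omega X'))) g
          (compose (carrier (fst (Omega X'))) k (Omega_map X' X f)))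
      = compose (fst X') (Sigma_map L L' g) (compose (fst X') (spatial_transpose X k) f)"
    by simp
qed

end
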